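(* Let $L,k$ be integers with $1\le k<L$, let $\lambda>0$, and let $f$ be the polynomial function $f=f^{(L,k)}:[0,1]\to\mathbb{R}$ defined in the context. Suppose $\bar u=(\bar u_m)_{m\in\mathbb{N}_0}$ is a sequence in $[0,1]$ satisfying $$\bar u_0=1,\qquad \bar u_{m+1}=\frac{\lambda f(\bar u_m)}{k}\quad\text{for all } m\in\mathbb{N}_0 .$$ Then the following upper and lower bounds hold: (i) $\bar u_m\le \lambda^{\frac{(L/k)^m-1}{L/k-1}}$ for all $m\in\mathbb{N}_0$; (ii) $\bar u_m\ge \lambda^{\frac{(L-k+1)^m-1}{L-k}}$ for all $m\in\mathbb{N}_0$.
   Context: $\mathbb{N}_0=\{0,1,2,\dots\}$. For integers $1\le k<L$, the function $f=f^{(L,k)}:[0,1]\to\mathbb{R}$ is $$f(x)=\sum_{i=1}^k\binom{L}{L-k+i}\binom{L-k+i-2}{i-1}(-1)^{i-1}x^{L-k+i},$$ with the convention $\binom{0}{0}=1$ and $\binom{a}{b}=0$ for $a<b$. *)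

theory Defs
  imports Complex_Main
begin

text \<open>
  Meant for \<^term>\<open>1 \<le> k \<and> k < L\<close> (and arguments in the unit interval); in that range none of the
  subtractions on \<^typ>\<open>nat\<close> truncates, since then \<open>L - k + i \<ge> 2\<close> for every \<open>i \<ge> 1\<close>.
\<close>

definition f_poly :: "nat \<Rightarrow> nat \<Rightarrow> real \<Rightarrow> real" where
  "f_poly L k x =
     (\<Sum>i = 1..k. real (L choose (L - k + i)) * real ((L - k + i - 2) choose (i - 1))
        * (- 1) ^ (i - 1) * x ^ (L - k + i))"

end

theory Submission
  imports Defs "HOL-Analysis.Convex"
begin

text \<open>
  If \<open>N\<close> is binomially distributed with parameters \<open>L\<close> and \<open>x\<close>, then \<open>f(x)\<close> is the expectation of
  \<open>max(N - (L - k), 0)\<close>. Conditioning on one of the \<open>L\<close> trials gives a Pascal-type recursion for this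
  expectation, and both \<open>k x\<^sup>L\<^sup>-\<^sup>k\<^sup>+\<^sup>1 \<le> f(x)\<close> and \<open>f(x) \<le> k x powr (L/k)\<close> follow from it by induction
  on \<open>L\<close>; the upper bound comes down to Bernoulli's inequality for exponents in the unit interval.
  Iterating the two bounds along the sequence produces the geometric sums in the exponents.
\<close>

text \<open>For \<open>x\<close> in the unit interval, the expectation of
  \<open>max (N - d) 0\<close> with \<open>N\<close> binomial in \<open>n\<close> trials. In the
  last equation a success lowers the remaining threshold by one and a failure leaves it.\<close>

fun binomial_excess :: "nat \<Rightarrow> nat \<Rightarrow> real \<Rightarrow> real" where
  "binomial_excess 0 d x = 0"
| "binomial_excess (Suc n) 0 x = real (Suc n) * x"
| "binomial_excess (Suc n) (Suc d) x =
     x * binomial_excess n d x + (1 - x) * binomial_excess n (Suc d) x"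

lemma binomial_excess_0_right: "binomial_excess n 0 x = real n * x"
  by (cases n) auto

lemma binomial_excess_at_0: "binomial_excess n d 0 = 0"
  by (induction n d "0::real" rule: binomial_excess.induct) auto

lemma binomial_excess_eq_0: "n \<le> d \<Longrightarrow> binomial_excess n d x = 0"
  by (induction n d x rule: binomial_excess.induct) auto

lemma binomial_excess_nonneg:
  assumes "0 \<le> x" "x \<le> 1"
  shows "0 \<le> binomial_excess n d x"
  using assms by (induction n d x rule: binomial_excess.induct) auto

text \<open>Pascal's rule matches the expansion with the recursion. Terms with \<open>s < d\<close>
  or \<open>s + 2 > n\<close> vanish, so the generous range spares side conditions in the
  induction.\<close>

lemma binomial_excess_Suc_eq_sum:
  "binomial_excess n (Suc d) x =
     (\<Sum>s<n. real (n choose (s + 2)) * real (s choose d) * (-1) ^ (s + d) * x ^ (s + 2))"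
proof (induction n arbitrary: d)
  case 0
  show ?case by simp
next
  case (Suc n)
  define S where "S c j = (\<Sum>s<n. real (n choose (s + 2)) * real (c s) * (-1) ^ (s + j) * x ^ (s + 2))"
    for c :: "nat \<Rightarrow> nat" and j :: nat
  have IH: "binomial_excess n (Suc j) x = S (\<lambda>s. s choose j) j" for j
    using Suc.IH[of j] by (simp add: S_def)
  have "(\<Sum>s<Suc n. real (Suc n choose (s + 2)) * real (s choose d) * (-1) ^ (s + d) * x ^ (s + 2))
     = (\<Sum>s<Suc n. real (n choose (s + 2)) * real (s choose d) * (-1) ^ (s + d) * x ^ (s + 2))
     + (\<Sum>s<Suc n. real (n choose (s + 1)) * real (s choose d) * (-1) ^ (s + d) * x ^ (s + 2))"
    by (simp add: algebra_simps flip: sum.distrib)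
  also have "(\<Sum>s<Suc n. real (n choose (s + 2)) * real (s choose d) * (-1) ^ (s + d) * x ^ (s + 2))
     = S (\<lambda>s. s choose d) d"
    by (simp add: S_def)
  \<comment> \<open>The index is shifted by one, at the price of a factor \<open>- x\<close>; the
    split-off term \<open>s = 0\<close> survives only for \<open>d = 0\<close>.\<close>
  also have "(\<Sum>s<Suc n. real (n choose (s + 1)) * real (s choose d) * (-1) ^ (s + d) * x ^ (s + 2))
     = real n * real (0 choose d) * (-1) ^ d * x ^ 2 - x * S (\<lambda>s. Suc s choose d) d"
    unfolding S_def sum.lessThan_Suc_shift
    by (simp add: sum_distrib_left algebra_simps power2_eq_square sum_negf)
  also have "real n * real (0 choose d) * (-1) ^ d * x ^ 2 - x * S (\<lambda>s. Suc s choose d) d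
     = x * binomial_excess n d x - x * S (\<lambda>s. s choose d) d"
  proof (cases d)
    case 0
    then show ?thesis
      by (simp add: binomial_excess_0_right power2_eq_square)
  next
    case (Suc e)
    \<comment> \<open>Pascal's rule again; the minus comes from lowering the sign parameter from
      \<open>Suc e\<close> to \<open>e\<close>.\<close>
    have "S (\<lambda>s. Suc s choose Suc e) (Suc e)
        = S (\<lambda>s. s choose Suc e) (Suc e) - S (\<lambda>s. s choose e) e"
      unfolding S_def sum_subtractf[symmetric]
      by (intro sum.cong) (auto simp: algebra_simps)
    then show ?thesis
      by (simp add: Suc IH right_diff_distrib del: binomial_Suc_Suc)
  qed
  finally show ?case
    by (simp add: IH algebra_simps)
qed

text \<open>With \<open>L - k = Suc d\<close>, substituting \<open>s = i - 1 + d\<close> turns the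
  defining sum into the expansion for a positive threshold.\<close>

lemma f_poly_eq_binomial_excess:
  assumes "k < L"
  shows "f_poly L k x = binomial_excess L (L - k) x"
proof -
  obtain d where L: "L = k + Suc d"
    using assms by (metis less_iff_Suc_add add_Suc_right)
  have "f_poly L k x = (\<Sum>i = 1..k. real (L choose (Suc d + i)) * real ((d + i - 1) choose (i - 1))
        * (- 1) ^ (i - 1) * x ^ (Suc d + i))"
    unfolding f_poly_def L by (intro sum.cong) auto
  also have "\<dots> = (\<Sum>i<k. real (L choose (i + d + 2)) * real ((i + d) choose d)
        * (- 1) ^ (i + d + d) * x ^ (i + d + 2))"
  proof -
    have "(d + i) choose i = (i + d) choose d" for i
      using binomial_symmetric[of i "d + i"] by (simp add: add.commute)
    then show ?thesis
      by (simp add: sum.atLeast1_atMost_eq power_add ac_simps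
          flip: power_mult_distrib)
  qed
  also have "\<dots> = (\<Sum>s\<in>{d..<k + d}. real (L choose (s + 2)) * real (s choose d)
        * (- 1) ^ (s + d) * x ^ (s + 2))"
    using sum.shift_bounds_nat_ivl[of "\<lambda>s. real (L choose (s + 2)) * real (s choose d)
        * (- 1) ^ (s + d) * x ^ (s + 2)" 0 d k] by (simp add: atLeast0LessThan)
  \<comment> \<open>The added terms vanish: \<open>s choose d\<close> is 0 for \<open>s < d\<close>,
    and \<open>L choose (s + 2)\<close> is 0 for \<open>s = k + d = L - 1\<close>.\<close>
  also have "\<dots> = (\<Sum>s<L. real (L choose (s + 2)) * real (s choose d)
        * (- 1) ^ (s + d) * x ^ (s + 2))"
    by (rule sum.mono_neutral_left) (auto simp: L binomial_eq_0 simp del: binomial_Suc_Suc)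
  finally show ?thesis
    by (simp add: L binomial_excess_Suc_eq_sum)
qed

text \<open>Only the success branch is kept: it preserves \<open>n - d\<close> and yields a factor
  \<open>x\<close> per step, down to equality at threshold 0.\<close>

lemma binomial_excess_lower:
  assumes "0 \<le> x" "x \<le> 1" "d \<le> n"
  shows "real (n - d) * x ^ (d + 1) \<le> binomial_excess n d x"
  using assms
proof (induction n d x rule: binomial_excess.induct)
  case (3 n d x)
  have "real (Suc n - Suc d) * x ^ (Suc d + 1) = x * (real (n - d) * x ^ (d + 1))"
    by (simp add: algebra_simps)
  also have "\<dots> \<le> x * binomial_excess n d x"
    using 3 by (intro mult_left_mono) auto
  also have "\<dots> \<le> binomial_excess (Suc n) (Suc d) x"
    using 3 binomial_excess_nonneg[of x n "Suc d"] by simp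
  finally show ?case .
qed auto

text \<open>Induction step of the upper bound, with \<open>s = n\<close> and
  \<open>m = n - d\<close>: success keeps \<open>m\<close>, failure lowers it by one. With
  \<open>p\<close> factored out, the two estimates add up to
  \<open>p * ((m - 1) * x + 1) + (1 - x) * (m - 1) * p = m * p\<close>.\<close>

lemma excess_step_inequality:
  fixes x m s :: real
  assumes x: "0 < x" "x \<le> 1" and m: "1 \<le> m" "m \<le> s"
  shows "x * (m * x powr (s / m)) + (1 - x) * ((m - 1) * x powr (s / (m - 1)))
           \<le> m * x powr ((s + 1) / m)"
proof -
  define p where "p = x powr ((s + 1) / m)"
  have 0: "(m - 1) * x powr (s / (m - 1)) \<le> (m - 1) * p"
  \<comment> \<open>For \<open>m = 1\<close> the exponent divides by zero, but the factor
    \<open>m - 1\<close> makes both sides 0.\<close>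
  proof (cases "m = 1")
    case False
    then have "(s + 1) / m \<le> s / (m - 1)"
      using m by (simp add: field_simps)
    then show ?thesis
      using x m powr_mono' unfolding p_def by (intro mult_left_mono) auto
  qed simp
  have 1: "(1 - x) * ((m - 1) * x powr (s / (m - 1))) \<le> (1 - x) * ((m - 1) * p)"
    using x by (intro mult_left_mono[OF 0]) auto
  \<comment> \<open>Young's inequality with second factor 1 is Bernoulli's inequality for the
    exponent \<open>1 - 1 / m\<close>.\<close>
  have "x powr (1 - 1 / m) * 1 powr (1 / m) \<le> (1 - 1 / m) * x + 1 / m * 1"
    using x m by (intro Youngs_inequality_0) auto
  then have "m * x powr (1 - 1 / m) \<le> (m - 1) * x + 1"
    using m by (simp add: field_simps)
  then have 2: "p * (m * x powr (1 - 1 / m)) \<le> p * ((m - 1) * x + 1)"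
    by (intro mult_left_mono) (auto simp: p_def)
  have "x * x powr (s / m) = x powr (1 + s / m)"
    using x by (simp add: powr_add)
  also have "1 + s / m = (s + 1) / m + (1 - 1 / m)"
    using m by (simp add: field_simps)
  also have "x powr \<dots> = p * x powr (1 - 1 / m)"
    by (simp add: powr_add p_def)
  finally have 3: "x * (m * x powr (s / m)) = p * (m * x powr (1 - 1 / m))"
    by (simp add: algebra_simps)
  show ?thesis
    using 1 2 unfolding p_def[symmetric] 3 by (simp add: algebra_simps)
qed

lemma binomial_excess_upper:
  assumes "0 \<le> x" "x \<le> 1" "d \<le> n"
  shows "binomial_excess n d x \<le> real (n - d) * x powr (real n / real (n - d))"
  using assms
proof (induction n d x rule: binomial_excess.induct)
  case (3 n d x)
  show ?case
  proof (cases "x = 0 \<or> n = d")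
    \<comment> \<open>Both sides are 0. For \<open>n = d\<close> the failure branch lies outside its
      induction hypothesis, and the step inequality needs \<open>0 < x\<close>.\<close>
    case True
    then show ?thesis
      using 3 by (auto simp: binomial_excess_at_0 binomial_excess_eq_0 simp del: binomial_excess.simps)
  next
    case False
    with 3 have less: "d < n" and x: "0 < x" "x \<le> 1" by auto
    define m where "m = real (n - d)"
    have m: "1 \<le> m" "m \<le> real n" "real (n - Suc d) = m - 1"
      using less by (auto simp: m_def of_nat_diff)
    have "binomial_excess n d x \<le> real (n - d) * x powr (real n / real (n - d))"
      using 3 less by auto
    moreover have "binomial_excess n (Suc d) x
        \<le> real (n - Suc d) * x powr (real n / real (n - Suc d))"
      using 3 less by auto
    ultimately have "binomial_excess (Suc n) (Suc d) x
        \<le> x * (m * x powr (n / m)) + (1 - x) * ((m - 1) * x powr (n / (m - 1)))"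
      using x unfolding binomial_excess.simps m(3) m_def[symmetric]
      by (intro add_mono mult_left_mono) auto
    also have "\<dots> \<le> m * x powr ((n + 1) / m)"
      using excess_step_inequality[OF x m(1,2)] by (simp add: add.commute)
    finally show ?thesis
      by (simp add: m_def add.commute)
  qed
qed (auto simp: powr_one)

text \<open>Passing from \<open>v\<close> to \<open>lam * v powr r\<close> sends an exponent
  \<open>e\<close> of \<open>lam\<close> to \<open>1 + r * e\<close>; the geometric sums obey this
  recursion.\<close>

lemma geometric_exponent_Suc:
  fixes r :: real
  assumes "r \<noteq> 1"
  shows "(r ^ Suc m - 1) / (r - 1) = 1 + r * ((r ^ m - 1) / (r - 1))"
  using assms by (simp add: field_simps)

theorem theorem2p2:
  fixes L k :: nat and lam :: real and u :: "nat \<Rightarrow> real"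
  assumes "1 \<le> k" and "k < L" and "lam > 0"
    and "\<And>m. u m \<in> {0..1}"
    and "u 0 = 1"
    and "\<And>m. u (Suc m) = lam * f_poly L k (u m) / real k"
  shows "(\<forall>m. u m \<le> lam powr (((real L / real k) ^ m - 1) / (real L / real k - 1))) \<and>
         (\<forall>m. u m \<ge> lam powr (((real L - real k + 1) ^ m - 1) / (real L - real k)))"
proof (intro conjI allI)
  have k: "0 < real k" "L - (L - k) = k" "real (L - k) = real L - real k"
    using assms(1,2) by (auto simp: of_nat_diff)
  have u: "0 \<le> u m" "u m \<le> 1" for m
    using assms(4)[of m] by auto
  have upper: "u (Suc m) \<le> lam * u m powr (real L / real k)" for m
  proof -
    have "f_poly L k (u m) \<le> real k * u m powr (real L / real k)"
      using binomial_excess_upper[OF u, of "L - k" L] k assms(2)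
      by (simp add: f_poly_eq_binomial_excess)
    then have "f_poly L k (u m) / real k \<le> u m powr (real L / real k)"
      using k by (simp add: field_simps)
    from mult_left_mono[OF this, of lam] show ?thesis
      using assms(3,6) by simp
  qed
  have lower: "lam * u m ^ (L - k + 1) \<le> u (Suc m)" for m
  proof -
    have "real k * u m ^ (L - k + 1) \<le> f_poly L k (u m)"
      using binomial_excess_lower[OF u, of "L - k" L] k assms(2)
      by (simp add: f_poly_eq_binomial_excess)
    then have "u m ^ (L - k + 1) \<le> f_poly L k (u m) / real k"
      using k by (simp add: field_simps)
    from mult_left_mono[OF this, of lam] show ?thesis
      using assms(3,6) by simp
  qed
  show "u m \<le> lam powr (((real L / real k) ^ m - 1) / (real L / real k - 1))" for m
  proof (induction m)
    case (Suc m)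
    let ?r = "real L / real k"
    have "u (Suc m) \<le> lam * u m powr ?r"
      by (rule upper)
    also have "\<dots> \<le> lam * (lam powr ((?r ^ m - 1) / (?r - 1))) powr ?r"
      using Suc u assms(3) by (intro mult_left_mono powr_mono2) auto
    also have "\<dots> = lam powr (1 + ?r * ((?r ^ m - 1) / (?r - 1)))"
      using assms(3) by (simp add: powr_powr powr_add mult.commute)
    also have "\<dots> = lam powr ((?r ^ Suc m - 1) / (?r - 1))"
      using assms(1,2) by (subst geometric_exponent_Suc) auto
    finally show ?case .
  qed (use assms in simp)
  show "lam powr (((real L - real k + 1) ^ m - 1) / (real L - real k)) \<le> u m" for m
  proof (induction m)
    case (Suc m)
    \<comment> \<open>With this ratio the denominator \<open>real L - real k\<close> becomes
      \<open>r - 1\<close>, and \<open>powr r\<close> is the natural power \<open>L - k + 1\<close>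
      of the lower bound.\<close>
    define r where "r = real L - real k + 1"
    have r: "real (L - k + 1) = r" "r \<noteq> 1" "real L - real k = r - 1"
      using k assms(2) by (auto simp: r_def)
    have "lam powr ((r ^ Suc m - 1) / (r - 1)) = lam powr (1 + r * ((r ^ m - 1) / (r - 1)))"
      by (simp only: geometric_exponent_Suc[OF r(2)])
    also have "\<dots> = lam * (lam powr ((r ^ m - 1) / (r - 1))) powr r"
      using assms(3) by (simp add: powr_powr powr_add mult.commute)
    also have "\<dots> = lam * (lam powr ((r ^ m - 1) / (r - 1))) ^ (L - k + 1)"
      using assms(3) by (subst powr_realpow[symmetric]) (auto simp: r(1)[symmetric])
    also have "\<dots> \<le> lam * u m ^ (L - k + 1)"
      using Suc assms(3) unfolding r(3) by (intro mult_left_mono power_mono) auto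
    also have "\<dots> \<le> u (Suc m)"
      by (rule lower)
    finally show ?case
      unfolding r(3) by simp
  qed (use assms in simp)
qed

end
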